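(* Let $(G,M,I)$ be a finite context, let $z\in G$, let $H=G\setminus\{z\}$, and let $K_H=(H,M,I\cap (H\times M))$ be the corresponding subcontext. Assume that $z^{\square\square}\neq\{z\}$, where $z^{\square\square}$ is the class containing $z$ of the finest extent partition of $(G,M,I)$. Let $\mathcal{T}$ be a classification tree in the box extent lattice $\mathcal{B}(K_H)$. Then: (i) $\mathcal{T}^{(1)}=\{E\in\mathcal{T}\mid E\in\mathcal{B}(G,M,I)\}$ is an order ideal in $\mathcal{T}$ (ordered by inclusion), $\mathcal{T}^{(2)}=\{E\in\mathcal{T}\mid E\cup\{z\}\in\mathcal{B}(G,M,I)\}$ is a finite chain in $\mathcal{T}$, and $\mathcal{T}^{(1)}\cap\mathcal{T}^{(2)}=\emptyset$. (ii) $\mathcal{T}^{\ast}=\mathcal{T}^{(1)}\cup\{E\cup\{z\}\mid E\in\mathcal{T}^{(2)}\}$ is a classification tree in the lattice $\mathcal{B}(G,M,I)$. (iii) If $\mathcal{T}$ contains all the atoms of the box extent lattice $\mathcal{B}(K_H)$, then $\mathcal{T}^{\ast}\cup\{z^{\square\square}\}$ is a classification tree in $\mathcal{B}(G,M,I)$ which contains all the atoms of $\mathcal{B}(G,M,I)$.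
   Context: A context is a triple $(G,M,I)$ with sets $G$ (objects), $M$ (attributes) and a relation $I\subseteq G\times M$. For $A\subseteq G$, $A'=\{m\in M\mid (g,m)\in I \text{ for all } g\in A\}$; for $B\subseteq M$, $B'=\{g\in G\mid (g,m)\in I\text{ for all } m\in B\}$. A (concept) extent is a set $A\subseteq G$ with $A''=A$. Standing assumptions: $G$ and $M$ are finite and nonempty, every object $g\in G$ has at least one attribute, and every attribute $m\in M$ is held by at least one object of $G$. An extent partition of $(G,M,I)$ is a partition of $G$ all of whose classes are extents. Common refinements of extent partitions are extent partitions, so there is a finest extent partition $\pi_\square$; for $g\in G$, $g^{\square\square}$ denotes the class of $\pi_\square$ containing $g$. A box extent of $(G,M,I)$ is a set $E\subseteq G$ that is a class of some extent partition of $(G,M,I)$ or equals $\emptyset''$. $\mathcal{B}(G,M,I)$ is the set of all box extents ordered by inclusion; it is a complete lattice with greatest element $G$ and least element $\emptyset''$. For the subcontext $K_H$ the derivation operators, extents, extent partitions and box extents are those computed in $K_H$ itself. In a lattice $L$ with least element $0$ and greatest element $1$, a nonempty subset $T\subseteq L\setminus\{0\}$ is a classification tree if for each $x\in L\setminus\{0\}$ the set $[x)\cap T$ is a nonempty chain, where $[x)=\{y\in L\mid y\geq x\}$ (in particular $1\in T$). *)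

theory Defs
  imports "HOL-Algebra.Complete_Lattice" "HOL-Library.Disjoint_Sets"
begin

section \<open>Contexts and extents\<close>

text \<open>
  The operators take the components of a context \<open>(G, M, I)\<close> as separate arguments, so that they
  can be evaluated verbatim in the subcontext \<open>(H, M, I \<inter> (H \<times> M))\<close>. In particular, in that
  subcontext \<open>\<emptyset>' = M\<close>, so that \<open>\<emptyset>''\<close> is the set of all objects of \<open>H\<close> that have every attribute
  of \<open>M\<close>.
\<close>

locale finite_context =
  fixes G :: "'g set" and M :: "'m set" and I :: "('g \<times> 'm) set"
  assumes incidence: "I \<subseteq> G \<times> M"
    and finite_objects: "finite G" and objects_nonempty: "G \<noteq> {}"
    and finite_attributes: "finite M" and attributes_nonempty: "M \<noteq> {}"
    and object_has_attribute: "\<And>g. g \<in> G \<Longrightarrow> \<exists>m\<in>M. (g, m) \<in> I"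
    and attribute_has_object: "\<And>m. m \<in> M \<Longrightarrow> \<exists>g\<in>G. (g, m) \<in> I"

definition common_attributes :: "'m set \<Rightarrow> ('g \<times> 'm) set \<Rightarrow> 'g set \<Rightarrow> 'm set" where
  "common_attributes M I A = {m \<in> M. \<forall>g\<in>A. (g, m) \<in> I}"

definition common_objects :: "'g set \<Rightarrow> ('g \<times> 'm) set \<Rightarrow> 'm set \<Rightarrow> 'g set" where
  "common_objects G I B = {g \<in> G. \<forall>m\<in>B. (g, m) \<in> I}"

definition extent_closure :: "'g set \<Rightarrow> 'm set \<Rightarrow> ('g \<times> 'm) set \<Rightarrow> 'g set \<Rightarrow> 'g set" where
  "extent_closure G M I A = common_objects G I (common_attributes M I A)"

definition is_extent :: "'g set \<Rightarrow> 'm set \<Rightarrow> ('g \<times> 'm) set \<Rightarrow> 'g set \<Rightarrow> bool" where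
  "is_extent G M I A \<longleftrightarrow> A \<subseteq> G \<and> extent_closure G M I A = A"


section \<open>Extent partitions and box extents\<close>

definition extent_partition :: "'g set \<Rightarrow> 'm set \<Rightarrow> ('g \<times> 'm) set \<Rightarrow> 'g set set \<Rightarrow> bool" where
  "extent_partition G M I P \<longleftrightarrow> partition_on G P \<and> (\<forall>C\<in>P. is_extent G M I C)"

text \<open>Existence and uniqueness are shown in \<open>finest_extent_partition\<close> below.\<close>

definition finest_extent_partition :: "'g set \<Rightarrow> 'm set \<Rightarrow> ('g \<times> 'm) set \<Rightarrow> 'g set set" where
  "finest_extent_partition G M I =
     (THE P. extent_partition G M I P \<and> (\<forall>Q. extent_partition G M I Q \<longrightarrow> refines G P Q))"

definition box_class :: "'g set \<Rightarrow> 'm set \<Rightarrow> ('g \<times> 'm) set \<Rightarrow> 'g \<Rightarrow> 'g set" where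
  "box_class G M I g = (THE C. C \<in> finest_extent_partition G M I \<and> g \<in> C)"

definition box_extents :: "'g set \<Rightarrow> 'm set \<Rightarrow> ('g \<times> 'm) set \<Rightarrow> 'g set set" where
  "box_extents G M I =
     {E. E \<subseteq> G \<and> ((\<exists>P. extent_partition G M I P \<and> E \<in> P) \<or> E = extent_closure G M I {})}"

definition box_lattice :: "'g set \<Rightarrow> 'm set \<Rightarrow> ('g \<times> 'm) set \<Rightarrow> 'g set gorder" where
  "box_lattice G M I = \<lparr>carrier = box_extents G M I, eq = (=), le = (\<subseteq>)\<rparr>"


section \<open>Classification trees\<close>

definition order_chain :: "('a, 'b) gorder_scheme \<Rightarrow> 'a set \<Rightarrow> bool" where
  "order_chain L C \<longleftrightarrow>
     C \<subseteq> carrier L \<and> (\<forall>x\<in>C. \<forall>y\<in>C. x \<sqsubseteq>\<^bsub>L\<^esub> y \<or> y \<sqsubseteq>\<^bsub>L\<^esub> x)"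

text \<open>\<open>S\<close> is a down-set of the subset \<open>T\<close> of \<open>L\<close> with the induced order; it may be empty.\<close>

definition order_ideal_in :: "('a, 'b) gorder_scheme \<Rightarrow> 'a set \<Rightarrow> 'a set \<Rightarrow> bool" where
  "order_ideal_in L T S \<longleftrightarrow> S \<subseteq> T \<and> (\<forall>x\<in>S. \<forall>y\<in>T. y \<sqsubseteq>\<^bsub>L\<^esub> x \<longrightarrow> y \<in> S)"

definition principal_filter :: "('a, 'b) gorder_scheme \<Rightarrow> 'a \<Rightarrow> 'a set" where
  "principal_filter L x = {y \<in> carrier L. x \<sqsubseteq>\<^bsub>L\<^esub> y}"

text \<open>Meaningful for bounded lattices \<open>L\<close>; see \<open>box_lattice_complete\<close> below.\<close>

definition classification_tree :: "('a, 'b) gorder_scheme \<Rightarrow> 'a set \<Rightarrow> bool" where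
  "classification_tree L T \<longleftrightarrow>
     T \<noteq> {} \<and> T \<subseteq> carrier L - {\<bottom>\<^bsub>L\<^esub>} \<and>
     (\<forall>x \<in> carrier L - {\<bottom>\<^bsub>L\<^esub>}.
        principal_filter L x \<inter> T \<noteq> {} \<and> order_chain L (principal_filter L x \<inter> T))"

definition lattice_atoms :: "('a, 'b) gorder_scheme \<Rightarrow> 'a set" where
  "lattice_atoms L =
     {a \<in> carrier L - {\<bottom>\<^bsub>L\<^esub>}. \<forall>x \<in> carrier L - {\<bottom>\<^bsub>L\<^esub>}. x \<sqsubseteq>\<^bsub>L\<^esub> a \<longrightarrow> x = a}"


section \<open>Well-definedness\<close>

lemma extent_closure_mono: "A \<subseteq> B \<Longrightarrow> extent_closure G M I A \<subseteq> extent_closure G M I B"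
  by (auto simp: extent_closure_def common_objects_def common_attributes_def)

lemma extent_closure_extensive: "A \<subseteq> G \<Longrightarrow> A \<subseteq> extent_closure G M I A"
  by (auto simp: extent_closure_def common_objects_def common_attributes_def)

lemma is_extent_Inter:
  assumes "\<A> \<noteq> {}" "\<And>A. A \<in> \<A> \<Longrightarrow> is_extent G M I A"
  shows "is_extent G M I (\<Inter>\<A>)"
proof -
  have sub: "\<Inter>\<A> \<subseteq> G"
    using assms by (auto simp: is_extent_def)
  have "extent_closure G M I (\<Inter>\<A>) \<subseteq> A" if "A \<in> \<A>" for A
    using extent_closure_mono[of "\<Inter>\<A>" A G M I] assms(2)[OF that] that
    by (auto simp: is_extent_def)
  then show ?thesis
    using sub extent_closure_extensive[OF sub, of M I] unfolding is_extent_def by blast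
qed

lemma is_extent_closure_empty: "is_extent G M I (extent_closure G M I {})"
  by (auto simp: is_extent_def extent_closure_def common_objects_def common_attributes_def)

lemma closure_empty_subset_extent: "is_extent G M I A \<Longrightarrow> extent_closure G M I {} \<subseteq> A"
  using extent_closure_mono[of "{}" A G M I] by (auto simp: is_extent_def)

lemma extent_partition_trivial: "G \<noteq> {} \<Longrightarrow> extent_partition G M I {G}"
  using extent_closure_extensive[of G G M I]
  by (auto simp: extent_partition_def partition_on_space is_extent_def
      extent_closure_def common_objects_def)

lemma extent_partition_common_refinement:
  assumes "\<P> \<noteq> {}" "\<And>P. P \<in> \<P> \<Longrightarrow> extent_partition G M I P"
  shows "extent_partition G M I (common_refinement \<P>)"
  unfolding extent_partition_def
proof (intro conjI ballI)
  show "partition_on G (common_refinement \<P>)"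
    using assms by (intro partition_on_common_refinement) (auto simp: extent_partition_def)
  fix C assume "C \<in> common_refinement \<P>"
  then obtain f where f: "f \<in> (\<Pi> P\<in>\<P>. P)" "C = \<Inter> (f ` \<P>)"
    by (auto simp: common_refinement)
  show "is_extent G M I C"
    unfolding f(2) using assms f(1)
    by (intro is_extent_Inter) (auto simp: extent_partition_def Pi_def)
qed

lemma finest_extent_partition:
  assumes "G \<noteq> {}"
  shows "extent_partition G M I (finest_extent_partition G M I)"
    and "\<And>Q. extent_partition G M I Q \<Longrightarrow> refines G (finest_extent_partition G M I) Q"
proof -
  let ?fin = "\<lambda>P. extent_partition G M I P \<and> (\<forall>Q. extent_partition G M I Q \<longrightarrow> refines G P Q)"
  let ?\<P> = "{P. extent_partition G M I P}"
  have ne: "?\<P> \<noteq> {}"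
    using extent_partition_trivial[OF assms] by blast
  have ep: "extent_partition G M I (common_refinement ?\<P>)"
    using ne by (rule extent_partition_common_refinement) simp
  have "refines G (common_refinement ?\<P>) Q" if Q: "extent_partition G M I Q" for Q
    unfolding refines_def
  proof (intro conjI ballI)
    show "partition_on G (common_refinement ?\<P>)" "partition_on G Q"
      using ep Q by (simp_all only: extent_partition_def)
    show "\<exists>Y\<in>Q. X \<subseteq> Y" if "X \<in> common_refinement ?\<P>" for X
      using common_refinement_exists[OF that] Q by blast
  qed
  then have "?fin (common_refinement ?\<P>)"
    using ep by blast
  moreover have "P = P'" if "?fin P" "?fin P'" for P P'
    using that by (intro refines_asym[of G]) auto
  ultimately have "\<exists>!P. ?fin P"
    by blast
  from theI'[OF this]
  show "extent_partition G M I (finest_extent_partition G M I)"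
    and "\<And>Q. extent_partition G M I Q \<Longrightarrow> refines G (finest_extent_partition G M I) Q"
    unfolding finest_extent_partition_def by blast+
qed

lemma box_class:
  assumes "g \<in> G"
  shows "box_class G M I g \<in> finest_extent_partition G M I" and "g \<in> box_class G M I g"
proof -
  have "partition_on G (finest_extent_partition G M I)"
    using finest_extent_partition(1)[of G M I] assms by (auto simp: extent_partition_def)
  then have "\<exists>!C. C \<in> finest_extent_partition G M I \<and> g \<in> C"
    using assms unfolding partition_on_def disjoint_def by (metis IntI UnionE empty_iff)
  from theI'[OF this]
  show "box_class G M I g \<in> finest_extent_partition G M I" "g \<in> box_class G M I g"
    unfolding box_class_def by blast+
qed

lemma box_extents_iff:
  "E \<in> box_extents G M I \<longleftrightarrow>
     (\<exists>P. extent_partition G M I P \<and> E \<in> P) \<or> E = extent_closure G M I {}"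
  by (auto simp: box_extents_def extent_partition_def is_extent_def extent_closure_def
      common_objects_def)

lemma box_extent_is_extent: "E \<in> box_extents G M I \<Longrightarrow> is_extent G M I E"
  using is_extent_closure_empty by (auto simp: box_extents_iff extent_partition_def)

lemma box_extents_Inter:
  assumes "\<A> \<subseteq> box_extents G M I" "\<A> \<noteq> {}"
  shows "\<Inter>\<A> \<in> box_extents G M I"
proof -
  let ?Z = "extent_closure G M I {}"
  have ext: "is_extent G M I (\<Inter>\<A>)"
    using assms by (intro is_extent_Inter box_extent_is_extent) auto
  show ?thesis
  proof (cases "\<Inter>\<A> = {} \<or> ?Z \<in> \<A>")
    case True
    then have "\<Inter>\<A> = ?Z"
      using closure_empty_subset_extent[OF ext] by blast
    then show ?thesis by (simp add: box_extents_iff)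
  next
    case False
    then have "\<forall>A\<in>\<A>. \<exists>P. extent_partition G M I P \<and> A \<in> P"
      using assms(1) box_extents_iff by fastforce
    then obtain p where p: "\<And>A. A \<in> \<A> \<Longrightarrow> extent_partition G M I (p A) \<and> A \<in> p A"
      by metis
    obtain x where x: "x \<in> \<Inter>\<A>" using False by blast
    have same: "A = B" if "A \<in> \<A>" "B \<in> \<A>" "p A = p B" for A B
    proof (rule ccontr)
      assume "A \<noteq> B"
      moreover have "A \<in> p A" "B \<in> p A" "disjoint (p A)"
        using p[OF that(1)] p[OF that(2)] that(3)
        by (auto simp: extent_partition_def partition_on_def)
      ultimately show False
        using x that by (auto simp: disjoint_def)
    qed
    define f where "f P = (THE A. A \<in> \<A> \<and> p A = P)" for P
    have f: "f (p A) = A" if "A \<in> \<A>" for A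
      unfolding f_def using same that by (intro the_equality) auto
    have "f ` p ` \<A> = \<A>"
      using f by force
    then have "\<Inter>\<A> \<in> {\<Inter> (f ` p ` \<A>)}"
      by simp
    moreover have "f \<in> (\<Pi> P\<in>p ` \<A>. P)"
      using f p by auto
    ultimately have "\<Inter>\<A> \<in> common_refinement (p ` \<A>)"
      using False unfolding common_refinement by blast
    moreover have "extent_partition G M I (common_refinement (p ` \<A>))"
      using p assms(2) by (intro extent_partition_common_refinement) auto
    ultimately show ?thesis by (auto simp: box_extents_iff)
  qed
qed

lemma box_lattice_complete:
  assumes "G \<noteq> {}"
  shows "complete_lattice (box_lattice G M I)"
proof (rule partial_order.complete_lattice_criterion1)
  let ?L = "box_lattice G M I"
  show "partial_order ?L"
    by unfold_locales (auto simp: box_lattice_def)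
  have "G \<in> box_extents G M I"
    using extent_partition_trivial[OF assms] by (auto simp: box_extents_iff)
  then show "\<exists>g. greatest ?L g (carrier ?L)"
    by (intro exI[of _ G]) (auto simp: greatest_def box_lattice_def box_extents_def)
  fix \<A> assume "\<A> \<subseteq> carrier ?L" "\<A> \<noteq> {}"
  then show "\<exists>i. greatest ?L i (Lower ?L \<A>)"
    using box_extents_Inter[of \<A> G M I]
    by (intro exI[of _ "\<Inter>\<A>"]) (auto simp: greatest_def Lower_def box_lattice_def)
qed

lemma box_lattice_bottom: "\<bottom>\<^bsub>box_lattice G M I\<^esub> = extent_closure G M I {}"
proof -
  have "least (box_lattice G M I) x (carrier (box_lattice G M I))
          \<longleftrightarrow> x = extent_closure G M I {}" for x
    using closure_empty_subset_extent[OF box_extent_is_extent, of _ G M I]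
      box_extents_iff[of "extent_closure G M I {}" G M I]
    by (auto simp: least_def box_lattice_def)
  then show ?thesis
    by (simp add: bottom_def)
qed

lemma box_lattice_top: "G \<noteq> {} \<Longrightarrow> \<top>\<^bsub>box_lattice G M I\<^esub> = G"
proof -
  assume "G \<noteq> {}"
  then have "G \<in> box_extents G M I"
    using extent_partition_trivial[of G M I] by (auto simp: box_extents_iff)
  then have "greatest (box_lattice G M I) x (carrier (box_lattice G M I)) \<longleftrightarrow> x = G" for x
    by (auto simp: greatest_def box_lattice_def box_extents_def)
  then show ?thesis
    by (simp add: top_def)
qed

end

theory Submission
  imports Defs
begin

text \<open>
  Suppose that \<open>\<emptyset>'' \<noteq> G\<close>. Then the non-bottom elements of the box extent lattice are precisely the
  classes of extent partitions (\<open>box_extents_minus_bottom\<close>), and a classification tree is a set \<open>T\<close>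
  of such classes in which every class lies below some member of \<open>T\<close> and the members above it form a
  chain (\<open>classification_tree_iff\<close>). If \<open>\<emptyset>'' = G\<close>, the lattice has one element and
  there is no classification tree at all. The existence of \<open>T\<close> therefore puts \<open>K_H\<close>, and with it
  \<open>(G, M, I)\<close>, in the first situation.

  Two transfers relate the classes of the two contexts. Deleting \<open>z\<close> from the classes of an extent
  partition of \<open>G\<close> gives an extent partition of \<open>H\<close> (\<open>class_trace\<close>). Conversely, a class of \<open>K_H\<close>
  that lies inside a class \<open>X\<close> of \<open>G\<close> with \<open>z \<notin> X\<close> is already a class of \<open>G\<close>: closing in \<open>G\<close> rather
  than in \<open>H\<close> can add \<open>z\<close> only, and \<open>X\<close> forbids this (\<open>class_lift\<close>). The second transfer makes
  \<open>T1\<close> an order ideal.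

  The class of \<open>z\<close> in the finest extent partition is contained in every class that it meets. As it is not
  \<open>{z}\<close>, no class of \<open>G\<close> is \<open>{z}\<close>. Hence, first, for \<open>E \<subseteq> H\<close> the sets \<open>E\<close> and \<open>E \<union> {z}\<close> are not both
  classes of \<open>G\<close>,
  since the class of \<open>z\<close> would be disjoint from \<open>E\<close> and contained in \<open>E \<union> {z}\<close>. Second, every class
  of \<open>G\<close> has a nonempty trace on \<open>H\<close>. The members of \<open>T2\<close> all lie above the trace of the class of
  \<open>z\<close>, so they form a chain. The members of \<open>Tstar\<close> above a class \<open>X\<close> come from members of \<open>T\<close>
  above the trace of \<open>X\<close>, which are comparable; adding \<open>z\<close> to some of them preserves this,
  because in a mixed pair the member of \<open>T2\<close> cannot lie below the member of the ideal \<open>T1\<close>.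

  Finally, the atoms are the classes of the finest extent partition. Such an atom of \<open>G\<close> without \<open>z\<close>
  is an atom for \<open>K_H\<close> as well, again by the second transfer, and adding the atom that contains \<open>z\<close> to
  a classification tree does not destroy the chain condition.
\<close>


section \<open>Classes of extent partitions\<close>

definition partition_classes :: "'g set \<Rightarrow> 'm set \<Rightarrow> ('g \<times> 'm) set \<Rightarrow> 'g set set" where
  "partition_classes G M I = {C. \<exists>P. extent_partition G M I P \<and> C \<in> P}"

lemma partition_classesE:
  assumes "C \<in> partition_classes G M I"
  obtains P where "extent_partition G M I P" "C \<in> P"
  using assms by (auto simp: partition_classes_def)

lemma partition_classesI: "extent_partition G M I P \<Longrightarrow> C \<in> P \<Longrightarrow> C \<in> partition_classes G M I"
  by (auto simp: partition_classes_def)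

lemma partition_class_subset: "C \<in> partition_classes G M I \<Longrightarrow> C \<subseteq> G"
  by (auto simp: partition_classes_def extent_partition_def is_extent_def)

lemma partition_class_nonempty: "C \<in> partition_classes G M I \<Longrightarrow> C \<noteq> {}"
  by (auto simp: partition_classes_def extent_partition_def partition_on_def)

lemma box_extents_eq: "box_extents G M I = insert (extent_closure G M I {}) (partition_classes G M I)"
  by (auto simp: box_extents_iff partition_classes_def)

lemma whole_in_partition_classes: "G \<noteq> {} \<Longrightarrow> G \<in> partition_classes G M I"
  using extent_partition_trivial[of G M I] by (auto simp: partition_classes_def)

text \<open>
  Every extent contains \<open>\<emptyset>''\<close>. If \<open>\<emptyset>''\<close> is a class of an extent partition, it is nonempty and has to
  lie in all other classes as well, so there are none and \<open>\<emptyset>'' = G\<close>.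
\<close>

lemma bottom_not_partition_class:
  assumes "extent_closure G M I {} \<noteq> G"
  shows "extent_closure G M I {} \<notin> partition_classes G M I"
proof
  let ?Z = "extent_closure G M I {}"
  assume "?Z \<in> partition_classes G M I"
  then obtain P where P: "extent_partition G M I P" "?Z \<in> P"
    by (rule partition_classesE)
  have "?Z \<noteq> {}" and union: "\<Union>P = G" and "disjoint P"
    using P by (auto simp: extent_partition_def partition_on_def)
  moreover have "?Z \<subseteq> C" if "C \<in> P" for C
    using closure_empty_subset_extent[of G M I C] P(1) that by (auto simp: extent_partition_def)
  ultimately have "C = ?Z" if "C \<in> P" for C
    using that P(2) unfolding disjoint_def by blast
  then have "\<Union>P = ?Z"
    using P(2) by blast
  then show False
    using union assms by simp
qed

lemma box_extents_minus_bottom: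
  assumes "extent_closure G M I {} \<noteq> G"
  shows "carrier (box_lattice G M I) - {\<bottom>\<^bsub>box_lattice G M I\<^esub>} = partition_classes G M I"
  unfolding box_lattice_bottom using bottom_not_partition_class[OF assms]
  by (auto simp: box_lattice_def box_extents_eq)

lemma partition_classes_trivial:
  assumes "extent_closure G M I {} = G"
  shows "box_extents G M I = {G}"
proof -
  have "C = G" if "C \<in> partition_classes G M I" for C
    using that closure_empty_subset_extent[of G M I C] assms partition_class_subset[OF that]
    by (auto simp: partition_classes_def extent_partition_def)
  then show ?thesis
    using assms by (auto simp: box_extents_eq)
qed

lemma classification_tree_bottom_neq:
  assumes "classification_tree (box_lattice G M I) T"
  shows "extent_closure G M I {} \<noteq> G"
proof
  assume "extent_closure G M I {} = G"
  then show False
    using assms partition_classes_trivial[of G M I]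
    by (auto simp: classification_tree_def box_lattice_bottom) (auto simp: box_lattice_def)
qed

lemma classification_tree_iff:
  assumes "extent_closure G M I {} \<noteq> G" "G \<noteq> {}"
  shows "classification_tree (box_lattice G M I) T \<longleftrightarrow>
    T \<subseteq> partition_classes G M I \<and>
    (\<forall>X \<in> partition_classes G M I. (\<exists>E\<in>T. X \<subseteq> E) \<and>
       (\<forall>E\<in>T. \<forall>F\<in>T. X \<subseteq> E \<longrightarrow> X \<subseteq> F \<longrightarrow> E \<subseteq> F \<or> F \<subseteq> E))"
proof -
  have carrier: "carrier (box_lattice G M I) = box_extents G M I"
    and sub: "partition_classes G M I \<subseteq> box_extents G M I"
    by (auto simp: box_lattice_def box_extents_eq)
  have le: "(X \<sqsubseteq>\<^bsub>box_lattice G M I\<^esub> Y) = (X \<subseteq> Y)" for X Y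
    by (simp add: box_lattice_def)
  have filter: "principal_filter (box_lattice G M I) X \<inter> T = {E \<in> T. X \<subseteq> E}"
    if "T \<subseteq> partition_classes G M I" for X
    using that sub by (auto simp: principal_filter_def le carrier)
  have chain: "order_chain (box_lattice G M I) {E \<in> T. X \<subseteq> E} \<longleftrightarrow>
      (\<forall>E\<in>T. \<forall>F\<in>T. X \<subseteq> E \<longrightarrow> X \<subseteq> F \<longrightarrow> E \<subseteq> F \<or> F \<subseteq> E)"
    if "T \<subseteq> partition_classes G M I" for X
    unfolding order_chain_def le carrier using that sub by blast
  have nonempty: "T \<noteq> {}" if "\<forall>X \<in> partition_classes G M I. \<exists>E\<in>T. X \<subseteq> E"
    using that whole_in_partition_classes[OF assms(2), of M I] by auto
  have exists: "{E \<in> T. X \<subseteq> E} \<noteq> {} \<longleftrightarrow> (\<exists>E\<in>T. X \<subseteq> E)" for X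
    by auto
  show ?thesis
  proof (cases "T \<subseteq> partition_classes G M I")
    case True
    show ?thesis
      unfolding classification_tree_def box_extents_minus_bottom[OF assms(1)]
        filter[OF True] chain[OF True] exists
      using True nonempty by meson
  next
    case False
    then show ?thesis
      unfolding classification_tree_def box_extents_minus_bottom[OF assms(1)] by simp
  qed
qed

text \<open>
  Any extent partition containing \<open>X\<close> is coarser than the finest one, so \<open>X\<close> is a union of finest
  classes.
\<close>

lemma box_class_least:
  assumes "g \<in> G" "X \<in> partition_classes G M I" "X \<inter> box_class G M I g \<noteq> {}"
  shows "box_class G M I g \<subseteq> X"
proof -
  obtain P where P: "extent_partition G M I P" "X \<in> P"
    using assms(2) by (rule partition_classesE)
  have "refines G (finest_extent_partition G M I) P"
    using finest_extent_partition(2)[OF _ P(1)] assms(1) by blast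
  then obtain Y where Y: "Y \<in> P" "box_class G M I g \<subseteq> Y"
    using box_class(1)[OF assms(1), of M I] unfolding refines_def by blast
  have "disjoint P"
    using P(1) by (auto simp: extent_partition_def partition_on_def)
  then have "X = Y"
    using Y P(2) assms(3) unfolding disjoint_def by blast
  then show ?thesis
    using Y(2) by simp
qed

lemma box_class_in_partition_classes:
  assumes "g \<in> G"
  shows "box_class G M I g \<in> partition_classes G M I"
proof (rule partition_classesI)
  show "extent_partition G M I (finest_extent_partition G M I)"
    by (rule finest_extent_partition(1)) (use assms in blast)
qed (rule box_class(1)[OF assms])

lemma lattice_atoms_iff:
  assumes "extent_closure G M I {} \<noteq> G"
  shows "A \<in> lattice_atoms (box_lattice G M I) \<longleftrightarrow>
    A \<in> partition_classes G M I \<and> (\<forall>X \<in> partition_classes G M I. X \<subseteq> A \<longrightarrow> X = A)"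
  unfolding lattice_atoms_def box_extents_minus_bottom[OF assms] by (simp add: box_lattice_def)


section \<open>Deleting one object\<close>

locale object_deletion =
  fixes G :: "'g set" and M :: "'m set" and I :: "('g \<times> 'm) set" and z :: 'g
    and H :: "'g set" and J :: "('g \<times> 'm) set"
  assumes z_in: "z \<in> G" and H_def: "H = G - {z}" and J_def: "J = I \<inter> (H \<times> M)"
begin

lemma closure_deletion:
  assumes "A \<subseteq> H"
  shows "extent_closure H M J A = extent_closure G M I A - {z}"
proof -
  have "common_attributes M J A = common_attributes M I A"
    using assms by (auto simp: common_attributes_def J_def)
  moreover have "common_objects H J B = common_objects G I B - {z}" if "B \<subseteq> M" for B
    using that by (auto simp: common_objects_def J_def H_def)
  moreover have "common_attributes M I A \<subseteq> M"
    by (auto simp: common_attributes_def)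
  ultimately show ?thesis
    by (simp add: extent_closure_def)
qed

lemma extent_trace:
  assumes "is_extent G M I C"
  shows "is_extent H M J (C - {z})"
proof -
  have sub: "C - {z} \<subseteq> H"
    using assms by (auto simp: is_extent_def H_def)
  have "extent_closure G M I (C - {z}) \<subseteq> C"
    using extent_closure_mono[of "C - {z}" C G M I] assms by (auto simp: is_extent_def)
  then show ?thesis
    using sub closure_deletion[OF sub] extent_closure_extensive[OF sub, of M J]
    by (auto simp: is_extent_def)
qed

lemma extent_Int_lift:
  assumes X: "is_extent G M I X" "z \<notin> X" and C: "is_extent H M J C"
  shows "is_extent G M I (X \<inter> C)"
proof -
  have "C \<subseteq> H"
    using C by (simp add: is_extent_def)
  then have "extent_closure G M I C - {z} = C"
    using C closure_deletion[of C] by (simp add: is_extent_def)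
  then have "extent_closure G M I (X \<inter> C) \<subseteq> X \<inter> C"
    using extent_closure_mono[of "X \<inter> C" X G M I] extent_closure_mono[of "X \<inter> C" C G M I] X
    by (auto simp: is_extent_def)
  moreover have "X \<inter> C \<subseteq> G"
    using X by (auto simp: is_extent_def)
  ultimately show ?thesis
    using extent_closure_extensive[of "X \<inter> C" G M I] by (auto simp: is_extent_def)
qed

lemma class_trace:
  assumes "C \<in> partition_classes G M I" "C \<noteq> {z}"
  shows "C - {z} \<in> partition_classes H M J"
proof -
  obtain P where P: "extent_partition G M I P" "C \<in> P"
    using assms(1) by (rule partition_classesE)
  have part: "\<Union>P = G" "disjoint P"
    using P(1) by (auto simp: extent_partition_def partition_on_def)
  let ?Q = "(\<lambda>D. D - {z}) ` P - {{}}"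
  have "partition_on H ?Q"
  proof (rule partition_onI)
    show "\<Union>?Q = H"
      using part(1) by (auto simp: H_def)
    fix p q assume pq: "p \<in> ?Q" "q \<in> ?Q" "p \<noteq> q"
    then obtain C D where CD: "C \<in> P" "D \<in> P" "p = C - {z}" "q = D - {z}"
      by auto
    then have "C \<inter> D = {}"
      using pq(3) part(2) by (auto simp: disjoint_def)
    then show "disjnt p q"
      using CD(3,4) by (auto simp: disjnt_def)
  qed auto
  moreover have "\<forall>D\<in>?Q. is_extent H M J D"
    using P(1) extent_trace by (auto simp: extent_partition_def)
  moreover have "C - {z} \<in> ?Q"
    using P(2) assms(2) partition_class_nonempty[OF assms(1)] by auto
  ultimately show ?thesis
    by (auto simp: partition_classes_def extent_partition_def)
qed

text \<open>
  The class \<open>X\<close> is split along an extent partition of \<open>H\<close> that contains \<open>Y\<close>; the pieces are extents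
  of \<open>G\<close>, and the other classes of \<open>G\<close> are kept.
\<close>

lemma class_lift:
  assumes "X \<in> partition_classes G M I" "z \<notin> X" "Y \<in> partition_classes H M J" "Y \<subseteq> X"
  shows "Y \<in> partition_classes G M I"
proof -
  obtain P where P: "extent_partition G M I P" "X \<in> P"
    using assms(1) by (rule partition_classesE)
  obtain Q where Q: "extent_partition H M J Q" "Y \<in> Q"
    using assms(3) by (rule partition_classesE)
  have partP: "\<Union>P = G" "disjoint P" "{} \<notin> P"
    using P(1) by (auto simp: extent_partition_def partition_on_def)
  have partQ: "\<Union>Q = H" "disjoint Q"
    using Q(1) by (auto simp: extent_partition_def partition_on_def)
  let ?S = "(\<lambda>C. X \<inter> C) ` Q - {{}}"
  let ?R = "(P - {X}) \<union> ?S"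
  have "X \<subseteq> H"
    using partition_class_subset[OF assms(1)] assms(2) by (auto simp: H_def)
  then have S: "\<Union>?S = X"
    using partQ(1) by blast
  have "partition_on G ?R"
  proof (rule partition_onI)
    show "\<Union>?R = G"
      unfolding Union_Un_distrib S using partP(1) P(2) by auto
    fix p q assume pq: "p \<in> ?R" "q \<in> ?R" "p \<noteq> q"
    have kept_split: "disjnt a b" if "a \<in> P - {X}" "b \<in> ?S" for a b
    proof -
      have "a \<inter> X = {}"
        using that(1) partP(2) P(2) by (auto simp: disjoint_def)
      then show ?thesis
        using that(2) by (auto simp: disjnt_def)
    qed
    have kept: "disjnt a b" if "a \<in> P" "b \<in> P" "a \<noteq> b" for a b
      using that partP(2) by (simp add: disjoint_def disjnt_def)
    have split: "disjnt a b" if ab: "a \<in> ?S" "b \<in> ?S" "a \<noteq> b" for a b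
    proof -
      obtain C D where CD: "C \<in> Q" "D \<in> Q" "a = X \<inter> C" "b = X \<inter> D"
        using ab(1,2) by auto
      then have "C \<inter> D = {}"
        using ab(3) partQ(2) by (auto simp: disjoint_def)
      then show ?thesis
        using CD(3,4) by (auto simp: disjnt_def)
    qed
    show "disjnt p q"
      using pq kept_split kept split by (metis DiffD1 UnE disjnt_sym)
  qed (use partP(3) in auto)
  moreover have "\<forall>D\<in>?R. is_extent G M I D"
    using P Q(1) extent_Int_lift[OF _ assms(2)] by (auto simp: extent_partition_def)
  moreover have "Y \<in> ?R"
    using Q(2) assms(4) partition_class_nonempty[OF assms(3)] by auto
  ultimately show ?thesis
    by (auto simp: partition_classes_def extent_partition_def)
qed

lemma closure_empty_deletion: "extent_closure H M J {} = extent_closure G M I {} - {z}"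
  by (rule closure_deletion) simp

end


section \<open>Restricting and extending a classification tree\<close>

locale tree_deletion = object_deletion G M I z H J
  for G :: "'g set" and M :: "'m set" and I :: "('g \<times> 'm) set" and z :: 'g
    and H :: "'g set" and J :: "('g \<times> 'm) set" +
  fixes T :: "'g set set" and Z :: "'g set"
  assumes Z_def: "Z = box_class G M I z" and Z_neq: "Z \<noteq> {z}"
    and tree: "classification_tree (box_lattice H M J) T"
begin

definition T1 where "T1 = {E \<in> T. E \<in> box_extents G M I}"
definition T2 where "T2 = {E \<in> T. E \<union> {z} \<in> box_extents G M I}"
definition Tstar where "Tstar = T1 \<union> {E \<union> {z} | E. E \<in> T2}"

lemma z_in_Z: "z \<in> Z"
  using box_class(2)[OF z_in] by (simp add: Z_def)

lemma Z_class: "Z \<in> partition_classes G M I"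
  using box_class_in_partition_classes[OF z_in] by (simp add: Z_def)

lemma Z_subset: "X \<in> partition_classes G M I \<Longrightarrow> X \<inter> Z \<noteq> {} \<Longrightarrow> Z \<subseteq> X"
  using box_class_least[OF z_in] by (simp add: Z_def)

lemma H_nonempty: "H \<noteq> {}"
  using Z_neq z_in_Z partition_class_subset[OF Z_class] by (auto simp: H_def)

lemma bottom_H: "extent_closure H M J {} \<noteq> H"
  using classification_tree_bottom_neq[OF tree] .

lemma bottom_G: "extent_closure G M I {} \<noteq> G"
  using bottom_H closure_empty_deletion H_def by metis

lemma classification_tree_GI:
  assumes "S \<subseteq> partition_classes G M I" "G \<in> S"
    and "\<And>X A B. X \<in> partition_classes G M I \<Longrightarrow> A \<in> S \<Longrightarrow> B \<in> S \<Longrightarrow> X \<subseteq> A \<Longrightarrow> X \<subseteq> B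
      \<Longrightarrow> A \<subseteq> B \<or> B \<subseteq> A"
  shows "classification_tree (box_lattice G M I) S"
proof -
  have "G \<noteq> {}"
    using z_in by auto
  show ?thesis
    unfolding classification_tree_iff[OF bottom_G \<open>G \<noteq> {}\<close>]
    using assms(1,2) partition_class_subset[of _ G M I]
    by (intro conjI ballI impI bexI[of _ G] assms(3))
qed

lemma T_subset: "T \<subseteq> partition_classes H M J"
  and T_above: "X \<in> partition_classes H M J \<Longrightarrow> \<exists>E\<in>T. X \<subseteq> E"
  and T_comparable: "X \<in> partition_classes H M J \<Longrightarrow> E \<in> T \<Longrightarrow> F \<in> T \<Longrightarrow> X \<subseteq> E \<Longrightarrow> X \<subseteq> F
    \<Longrightarrow> E \<subseteq> F \<or> F \<subseteq> E"
  using tree unfolding classification_tree_iff[OF bottom_H H_nonempty] by blast+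

lemma T_subset_H: "E \<in> T \<Longrightarrow> E \<subseteq> H"
  using T_subset partition_class_subset by blast

lemma z_notin_T: "E \<in> T \<Longrightarrow> z \<notin> E"
  using T_subset_H by (auto simp: H_def)

text \<open>
  A box extent of \<open>G\<close> whose trace on \<open>H\<close> belongs to \<open>T\<close> is not the least one, because the trace of
  the least one is the bottom of the box extent lattice of \<open>K_H\<close>.
\<close>

lemma T_trace_partition_class:
  assumes "E \<in> T" "X \<in> box_extents G M I" "X - {z} = E"
  shows "X \<in> partition_classes G M I"
  using assms bottom_not_partition_class[OF bottom_H] T_subset
  by (auto simp: box_extents_eq closure_empty_deletion)

lemma T1_iff: "E \<in> T1 \<longleftrightarrow> E \<in> T \<and> E \<in> partition_classes G M I"
  using T_trace_partition_class[of E E] z_notin_T by (auto simp: T1_def box_extents_eq)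

lemma T2_iff: "E \<in> T2 \<longleftrightarrow> E \<in> T \<and> E \<union> {z} \<in> partition_classes G M I"
  using T_trace_partition_class[of E "E \<union> {z}"] z_notin_T by (auto simp: T2_def box_extents_eq)

lemma TstarE:
  assumes "S \<in> Tstar"
  obtains (unextended) "S \<in> T1" | (extended) E where "E \<in> T2" "S = E \<union> {z}"
  using assms by (auto simp: Tstar_def)

lemma T1_down_closed:
  assumes "E \<in> T1" "F \<in> T" "F \<subseteq> E"
  shows "F \<in> T1"
  using assms class_lift[of E F] z_notin_T T_subset by (auto simp: T1_iff)

lemma T1_T2_disjoint: "T1 \<inter> T2 = {}"
proof (rule ccontr)
  assume "T1 \<inter> T2 \<noteq> {}"
  then obtain E where E: "E \<in> T" "E \<in> partition_classes G M I" "E \<union> {z} \<in> partition_classes G M I"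
    by (auto simp: T1_iff T2_iff)
  have "E \<inter> Z = {}"
    using Z_subset[OF E(2)] z_in_Z z_notin_T[OF E(1)] by blast
  moreover have "Z \<subseteq> E \<union> {z}"
    using Z_subset[OF E(3)] z_in_Z by blast
  ultimately show False
    using z_in_Z Z_neq by blast
qed

lemma T2_comparable:
  assumes "E \<in> T2" "F \<in> T2"
  shows "E \<subseteq> F \<or> F \<subseteq> E"
proof (rule T_comparable)
  show "Z - {z} \<in> partition_classes H M J"
    using class_trace[OF Z_class Z_neq] .
  have "Z \<subseteq> E \<union> {z}" "Z \<subseteq> F \<union> {z}"
    using assms Z_subset z_in_Z by (auto simp: T2_iff)
  then show "Z - {z} \<subseteq> E" "Z - {z} \<subseteq> F"
    by blast+
qed (use assms in \<open>auto simp: T2_iff\<close>)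

lemma partition_class_neq: "X \<in> partition_classes G M I \<Longrightarrow> X \<noteq> {z}"
  using Z_subset[of X] z_in_Z Z_neq by blast

lemma Tstar_mixed_comparable:
  assumes "E \<in> T1" "F \<in> T2" "E \<subseteq> F \<or> F \<subseteq> E"
  shows "E \<subseteq> F"
  using assms T1_down_closed[of E F] T1_T2_disjoint by (auto simp: T2_iff)

lemma Tstar_comparable:
  assumes X: "X \<in> partition_classes G M I"
    and "A \<in> Tstar" "B \<in> Tstar" "X \<subseteq> A" "X \<subseteq> B"
  shows "A \<subseteq> B \<or> B \<subseteq> A"
proof -
  have trace: "X - {z} \<in> partition_classes H M J"
    using class_trace[OF X partition_class_neq[OF X]] .
  have cmp: "E \<subseteq> F \<or> F \<subseteq> E" if "E \<in> T" "F \<in> T" "X - {z} \<subseteq> E" "X - {z} \<subseteq> F" for E F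
    using T_comparable[OF trace] that by blast
  have mixed: "E \<subseteq> F \<union> {z}" if "E \<in> T1" "F \<in> T2" "X \<subseteq> E" "X \<subseteq> F \<union> {z}" for E F
    using Tstar_mixed_comparable[OF that(1,2)] cmp[of E F] that by (auto simp: T1_iff T2_iff)
  from assms(2) show ?thesis
  proof (cases rule: TstarE)
    case A: unextended
    from assms(3) show ?thesis
    proof (cases rule: TstarE)
      case unextended
      then show ?thesis
        using A cmp[of A B] assms(4,5) by (auto simp: T1_iff)
    next
      case (extended F)
      then show ?thesis
        using A mixed[of A F] assms(4,5) by blast
    qed
  next
    case A: (extended E)
    from assms(3) show ?thesis
    proof (cases rule: TstarE)
      case unextended
      then show ?thesis
        using A mixed[of B E] assms(4,5) by blast
    next
      case (extended F)
      then show ?thesis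
        using A T2_comparable[of E F] by blast
    qed
  qed
qed

lemma Tstar_subset: "Tstar \<subseteq> partition_classes G M I"
  by (auto simp: Tstar_def T1_iff T2_iff)

lemma whole_in_Tstar: "G \<in> Tstar"
proof -
  obtain E where "E \<in> T" "H \<subseteq> E"
    using T_above[OF whole_in_partition_classes[OF H_nonempty]] by blast
  then have "H \<in> T"
    using T_subset_H[of E] by (metis subset_antisym)
  moreover have "H \<union> {z} = G"
    using z_in by (auto simp: H_def)
  ultimately have "H \<in> T2"
    using whole_in_partition_classes[of G M I] z_in by (auto simp: T2_iff)
  then show ?thesis
    using \<open>H \<union> {z} = G\<close> by (auto simp: Tstar_def)
qed

lemma Tstar_tree: "classification_tree (box_lattice G M I) Tstar"
  using Tstar_subset whole_in_Tstar Tstar_comparable by (rule classification_tree_GI)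

text \<open>A class contained in \<open>Z\<close> equals \<open>Z\<close>, so \<open>Z\<close> is compared only with members that contain it.\<close>

lemma Tstar_insert_tree: "classification_tree (box_lattice G M I) (Tstar \<union> {Z})"
proof (rule classification_tree_GI)
  fix X A B
  assume X: "X \<in> partition_classes G M I"
    and AB: "A \<in> Tstar \<union> {Z}" "B \<in> Tstar \<union> {Z}" "X \<subseteq> A" "X \<subseteq> B"
  have "Z \<subseteq> Y" if "X \<subseteq> Z" "X \<subseteq> Y" for Y
    using Z_subset[OF X] partition_class_nonempty[OF X] that by blast
  then show "A \<subseteq> B \<or> B \<subseteq> A"
    using AB Tstar_comparable[OF X, of A B] by auto
qed (use Tstar_subset Z_class whole_in_Tstar in auto)

lemma atoms_in_Tstar:
  assumes "lattice_atoms (box_lattice H M J) \<subseteq> T"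
  shows "lattice_atoms (box_lattice G M I) \<subseteq> Tstar \<union> {Z}"
proof
  fix A assume "A \<in> lattice_atoms (box_lattice G M I)"
  then have A: "A \<in> partition_classes G M I"
    and min: "\<And>X. X \<in> partition_classes G M I \<Longrightarrow> X \<subseteq> A \<Longrightarrow> X = A"
    by (auto simp: lattice_atoms_iff[OF bottom_G])
  show "A \<in> Tstar \<union> {Z}"
  proof (cases "z \<in> A")
    case True
    then have "Z = A"
      using Z_subset[OF A] z_in_Z min[OF Z_class] by blast
    then show ?thesis by simp
  next
    case False
    then have "A \<in> partition_classes H M J"
      using class_trace[OF A partition_class_neq[OF A]] by simp
    moreover have "X = A" if "X \<in> partition_classes H M J" "X \<subseteq> A" for X
      using min[OF class_lift[OF A False that] that(2)] .
    ultimately have "A \<in> T"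
      using assms lattice_atoms_iff[OF bottom_H] by blast
    then show ?thesis
      using A by (auto simp: Tstar_def T1_iff)
  qed
qed

end


section \<open>Classification trees in the two box extent lattices\<close>

theorem theorem3p8:
  fixes G :: "'g set" and M :: "'m set" and I :: "('g \<times> 'm) set" and z :: 'g
    and H :: "'g set" and J :: "('g \<times> 'm) set" and T T1 T2 Tstar :: "'g set set"
  assumes "finite_context G M I"
    and "z \<in> G"
    and "H = G - {z}"
    and "J = I \<inter> (H \<times> M)"
    and "box_class G M I z \<noteq> {z}"
    and "classification_tree (box_lattice H M J) T"
    and "T1 = {E \<in> T. E \<in> box_extents G M I}"
    and "T2 = {E \<in> T. E \<union> {z} \<in> box_extents G M I}"
    and "Tstar = T1 \<union> {E \<union> {z} | E. E \<in> T2}"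
  shows "(order_ideal_in (box_lattice H M J) T T1 \<and>
          finite T2 \<and> T2 \<subseteq> T \<and> order_chain (box_lattice H M J) T2 \<and>
          T1 \<inter> T2 = {}) \<and>
         classification_tree (box_lattice G M I) Tstar \<and>
         (lattice_atoms (box_lattice H M J) \<subseteq> T \<longrightarrow>
            classification_tree (box_lattice G M I) (Tstar \<union> {box_class G M I z}) \<and>
            lattice_atoms (box_lattice G M I) \<subseteq> Tstar \<union> {box_class G M I z})"
proof -
  interpret tree_deletion G M I z H J T "box_class G M I z"
    using assms(2-6) by unfold_locales auto
  have eqs: "T1 = local.T1" "T2 = local.T2" "Tstar = local.Tstar"
    using assms(7-9) by (simp_all add: T1_def T2_def Tstar_def)
  have "T \<subseteq> Pow H"
    using T_subset_H by blast
  moreover have "finite H"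
    using finite_context.finite_objects[OF assms(1)] assms(3) by simp
  ultimately have "finite T2"
    using assms(8) by (auto intro: finite_subset[of _ "Pow H"])
  moreover have "order_ideal_in (box_lattice H M J) T T1"
    using T1_down_closed by (auto simp: eqs order_ideal_in_def T1_iff box_lattice_def)
  moreover have "order_chain (box_lattice H M J) T2"
    using T2_comparable T_subset by (auto simp: eqs order_chain_def T2_iff box_lattice_def box_extents_eq)
  moreover have "T2 \<subseteq> T" "T1 \<inter> T2 = {}"
    using T1_T2_disjoint by (auto simp: eqs T2_iff)
  ultimately show ?thesis
    using Tstar_tree Tstar_insert_tree atoms_in_Tstar by (simp add: eqs)
qed

end
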